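(* Let $n,j\ge1$ be integers with $n-j\ge5$. Then the function ${}_np_j(\alpha)$ has a root in the open interval $\left(\frac1{\sqrt5},\frac12\right)$.
   Context: $P_n$ is the path graph on vertices $1,\dots,n$ with edges $\{i,i+1\}$, $1\le i<n$, and adjacency matrix $A$. For $0<\alpha<1/\rho(A)$ (in particular for $0<\alpha<1/2$), the Katz matrix is $K_{P_n}(\alpha)=\sum_{t=1}^\infty\alpha^tA^t=(I-\alpha A)^{-1}-I$. For $1\le j\le n-2$ define \[ {}_np_j(\alpha)=\min_{1\le i\le n-j}K_{P_n}(\alpha)_{i,i+j}-\max_{1\le i\le n-j-1}K_{P_n}(\alpha)_{i,i+j+1}. \] *)

theory Defs
  imports Complex_Main "Jordan_Normal_Form.Matrix"
begin

definition path_edges :: "nat \<Rightarrow> nat set set" where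
  "path_edges n = {{i, i + 1} | i. 1 \<le> i \<and> i < n}"

(* Vertices are 1, ..., n, whereas rows and columns of the library's matrices are numbered
   from 0: row r belongs to vertex r + 1. *)
definition path_adj_mat :: "nat \<Rightarrow> real mat" where
  "path_adj_mat n = mat n n (\<lambda>(r, c). if {r + 1, c + 1} \<in> path_edges n then 1 else 0)"

(* The sum of alpha^t A^t over t >= 1, taken entrywise. It is meaningful where the series
   converges, in particular for 0 < alpha < 1 / rho(A); suminf is unspecified elsewhere. *)
definition katz_mat :: "real mat \<Rightarrow> real \<Rightarrow> real mat" where
  "katz_mat A \<alpha> = mat (dim_row A) (dim_row A)
     (\<lambda>(r, c). \<Sum>t. (\<alpha> ^ Suc t \<cdot>\<^sub>m (A ^\<^sub>m Suc t)) $$ (r, c))"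

(* The entry at a pair of vertices i, k in {1..n}. *)
definition katz_path :: "nat \<Rightarrow> real \<Rightarrow> nat \<Rightarrow> nat \<Rightarrow> real" where
  "katz_path n \<alpha> i k = katz_mat (path_adj_mat n) \<alpha> $$ (i - 1, k - 1)"

(* Meant for 1 <= j <= n - 2, where both index sets are nonempty. *)
definition katz_gap :: "nat \<Rightarrow> nat \<Rightarrow> real \<Rightarrow> real" where
  "katz_gap n j \<alpha> =
     (MIN i\<in>{1..n - j}. katz_path n \<alpha> i (i + j)) -
     (MAX i\<in>{1..n - j - 1}. katz_path n \<alpha> i (i + j + 1))"

end

(* Off the diagonal, the Katz matrix of the path agrees with (I - alpha A)^(-1), whose entries
   at i <= k are U i * U (n + 1 - k) / (alpha * U (n + 1)), where U is the Lucas sequence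
   U (m + 2) = x * U (m + 1) - U m with x = 1 / alpha. The identity
     U (i + k) * U (i + l) - U i * U (i + k + l) = U k * U l
   shows that along a band the entries are smallest at the ends and largest in the middle. With
   m = n - j and h = m div 2, the gap is a positive multiple of U m - U h * U (m - h). This is
   continuous in alpha, positive at 1 / sqrt 5, where U m = phi^m - phi^(-m) for the golden
   ratio phi, and negative at 1 / 2, where U m = m. *)

theory Submission
  imports Defs
begin

section \<open>The Lucas sequence: identities, growth, and values at 2 and sqrt 5\<close>

fun lucas_U :: "real \<Rightarrow> nat \<Rightarrow> real" where
  "lucas_U x 0 = 0"
| "lucas_U x (Suc 0) = 1"
| "lucas_U x (Suc (Suc m)) = x * lucas_U x (Suc m) - lucas_U x m"

text \<open>The left side is the Casoratian of the sequence and its shift by \<open>l\<close>. The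
  recurrence makes it independent of \<open>i\<close>, and at \<open>i = 0\<close> it is
  \<open>lucas_U x l\<close>.\<close>

lemma lucas_U_docagne:
  "lucas_U x (Suc i) * lucas_U x (i + l) - lucas_U x i * lucas_U x (Suc (i + l)) = lucas_U x l"
  by (induction i) (simp_all add: algebra_simps)

text \<open>As functions of \<open>k\<close> both sides satisfy the Lucas recurrence, so it is
  enough to compare them at 0 and at 1; the latter case is \<open>lucas_U_docagne\<close>.\<close>

lemma lucas_U_vajda:
  "lucas_U x (i + k) * lucas_U x (i + l) - lucas_U x i * lucas_U x (i + k + l) =
    lucas_U x k * lucas_U x l"
proof (induction x k rule: lucas_U.induct)
  case (2 x)
  show ?case using lucas_U_docagne[of x i l] by simp
qed (simp_all add: algebra_simps)

lemma lucas_U_add: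
  "lucas_U x (Suc (k + l)) = lucas_U x (Suc k) * lucas_U x (Suc l) - lucas_U x k * lucas_U x l"
  using lucas_U_vajda[of x 1 k l] by simp

text \<open>For x >= 2 the increments do not decrease as long as the sequence is nonnegative, so
  both claims have to go through one induction.\<close>

lemma lucas_U_strict_mono:
  assumes "x \<ge> 2"
  shows "lucas_U x m < lucas_U x (Suc m) \<and> 0 \<le> lucas_U x m"
proof (induction m)
  case (Suc m)
  have "2 * lucas_U x (Suc m) \<le> x * lucas_U x (Suc m)"
    using assms Suc by (intro mult_right_mono) auto
  then show ?case
    using Suc unfolding lucas_U.simps by (elim conjE, intro conjI) linarith+
qed simp

lemma lucas_U_nonneg: "x \<ge> 2 \<Longrightarrow> lucas_U x m \<ge> 0"
  using lucas_U_strict_mono by blast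

lemma lucas_U_pos: "x \<ge> 2 \<Longrightarrow> m > 0 \<Longrightarrow> lucas_U x m > 0"
  using lucas_U_strict_mono[of x "m - 1"] by (cases m) auto

lemma lucas_U_two: "lucas_U 2 m = real m"
  by (induction "2::real" m rule: lucas_U.induct) auto

lemma continuous_on_lucas_U [continuous_intros]:
  "continuous_on S f \<Longrightarrow> continuous_on S (\<lambda>y. lucas_U (f y) m)"
proof (induction m rule: less_induct)
  case (less m)
  show ?case
  proof (cases "m < 2")
    case True
    then have "m = 0 \<or> m = 1" by auto
    then show ?thesis by auto
  next
    case False
    then obtain l where l: "m = Suc (Suc l)" by (metis add_2_eq_Suc le_Suc_ex not_less)
    with less show ?thesis by (auto intro!: continuous_intros)
  qed
qed

text \<open>Binet's formula: the two bases are the roots of y^2 = sqrt 5 * y - 1. They differ by 1,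
  hence no denominator.\<close>

lemma lucas_U_sqrt5:
  "lucas_U (sqrt 5) m = ((sqrt 5 + 1) / 2) ^ m - ((sqrt 5 - 1) / 2) ^ m"
proof (induction "sqrt 5" m rule: lucas_U.induct)
  case (3 m)
  have s: "sqrt 5 * sqrt 5 = (5::real)" by simp
  have p: "((sqrt 5 + 1) / 2) ^ Suc (Suc m) =
      sqrt 5 * ((sqrt 5 + 1) / 2) ^ Suc m - ((sqrt 5 + 1) / 2) ^ m"
    using s by (simp add: field_simps)
  have q: "((sqrt 5 - 1) / 2) ^ Suc (Suc m) =
      sqrt 5 * ((sqrt 5 - 1) / 2) ^ Suc m - ((sqrt 5 - 1) / 2) ^ m"
    using s by (simp add: field_simps)
  show ?case unfolding lucas_U.simps 3 p q by (simp add: algebra_simps)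
qed (simp_all add: field_simps)

text \<open>With p > q > 0 the two bases of Binet's formula, right side minus left side is q^b (p^a
  - q^a) + q^a (p^b - q^b), whose first summand is positive because a > 0.\<close>

lemma lucas_U_sqrt5_mult_less:
  assumes "a > 0"
  shows "lucas_U (sqrt 5) a * lucas_U (sqrt 5) b < lucas_U (sqrt 5) (a + b)"
proof -
  define p q where "p = (sqrt 5 + 1) / 2" and "q = (sqrt 5 - 1) / (2::real)"
  have r: "2 < sqrt (5::real)" "sqrt (5::real) < 3"
    by (simp_all add: real_less_rsqrt real_less_lsqrt)
  then have q: "0 < q" "q < p" by (auto simp: p_def q_def)
  have "q ^ a * q ^ b < p ^ a * q ^ b" "q ^ a * q ^ b \<le> q ^ a * p ^ b"
    using q assms by (auto intro!: mult_strict_right_mono power_strict_mono mult_left_mono power_mono)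
  then show ?thesis
    unfolding lucas_U_sqrt5 p_def[symmetric] q_def[symmetric] by (simp add: power_add algebra_simps)
qed

section \<open>The adjacency matrix, its resolvent and the Katz series\<close>

lemma path_adj_mat_carrier [simp]: "path_adj_mat n \<in> carrier_mat n n"
  by (simp add: path_adj_mat_def)

lemma path_adj_mat_index:
  assumes "r < n" "c < n"
  shows "path_adj_mat n $$ (r, c) = (if c = Suc r \<or> r = Suc c then 1 else 0)"
  using assms by (auto simp: path_adj_mat_def path_edges_def doubleton_eq_iff)

lemma path_adj_mat_mult_index:
  assumes M: "M \<in> carrier_mat n n" and "r < n" "c < n"
  shows "(path_adj_mat n * M) $$ (r, c) =
    (if r > 0 then M $$ (r - 1, c) else 0) + (if Suc r < n then M $$ (Suc r, c) else 0)"
proof -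
  have "(path_adj_mat n * M) $$ (r, c) = (\<Sum>i = 0..<n. path_adj_mat n $$ (r, i) * M $$ (i, c))"
    using assms carrier_matD[OF path_adj_mat_carrier] carrier_matD[OF M]
    by (simp add: scalar_prod_def)
  \<comment> \<open>The guard \<open>r > 0\<close> matters: at \<open>r = 0\<close> the truncated
    \<open>r - 1\<close> would be \<open>r\<close> itself.\<close>
  also have "\<dots> = (\<Sum>i = 0..<n. (if r > 0 \<and> i = r - 1 then M $$ (i, c) else 0) +
      (if i = Suc r then M $$ (i, c) else 0))"
    using assms by (intro sum.cong) (auto simp: path_adj_mat_index)
  also have "\<dots> = (\<Sum>i = 0..<n. if r > 0 \<and> i = r - 1 then M $$ (i, c) else 0) +
      (\<Sum>i = 0..<n. if i = Suc r then M $$ (i, c) else 0)"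
    by (rule sum.distrib)
  also have "(\<Sum>i = 0..<n. if r > 0 \<and> i = r - 1 then M $$ (i, c) else 0) =
      (if r > 0 then M $$ (r - 1, c) else 0)"
    using \<open>r < n\<close> by (cases "r > 0") auto
  also have "(\<Sum>i = 0..<n. if i = Suc r then M $$ (i, c) else 0) =
      (if Suc r < n then M $$ (Suc r, c) else 0)"
    by auto
  finally show ?thesis .
qed

text \<open>Closed form of the inverse of I - alpha A. Indices start at 0, so vertices i <= k appear
  as \<open>Suc (min r c)\<close> and n + 1 - k as \<open>n - max r c\<close>.\<close>

definition path_resolvent :: "nat \<Rightarrow> real \<Rightarrow> real mat" where
  "path_resolvent n \<alpha> = mat n n (\<lambda>(r, c).
     lucas_U (1 / \<alpha>) (Suc (min r c)) * lucas_U (1 / \<alpha>) (n - max r c) /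
       (\<alpha> * lucas_U (1 / \<alpha>) (Suc n)))"

lemma path_resolvent_carrier [simp]: "path_resolvent n \<alpha> \<in> carrier_mat n n"
  by (simp add: path_resolvent_def)

text \<open>Down a fixed column, the entries follow the Lucas recurrence on either side of the
  diagonal; the denominator is normalised so that the defect on the diagonal is 1. The fixed-point
  form is the one that telescopes against the powers of A.\<close>

lemma path_resolvent_eq:
  assumes "0 < \<alpha>" "\<alpha> < 1 / 2"
  shows "path_resolvent n \<alpha> = 1\<^sub>m n + \<alpha> \<cdot>\<^sub>m (path_adj_mat n * path_resolvent n \<alpha>)"
proof (rule eq_matI)
  let ?A = "path_adj_mat n" and ?R = "path_resolvent n \<alpha>"
  let ?U = "lucas_U (1 / \<alpha>)"
  fix r c assume "r < dim_row (1\<^sub>m n + \<alpha> \<cdot>\<^sub>m (?A * ?R))" "c < dim_col (1\<^sub>m n + \<alpha> \<cdot>\<^sub>m (?A * ?R))"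
  then have rc: "r < n" "c < n"
    by (auto simp: path_resolvent_def path_adj_mat_def)
  have "?U (Suc n) > 0" using assms by (intro lucas_U_pos) (auto simp: field_simps)
  define d where "d = \<alpha> * ?U (Suc n)"
  have d: "d > 0" using assms \<open>?U (Suc n) > 0\<close> by (simp add: d_def)
  have rec: "\<alpha> * (?U m + ?U (Suc (Suc m))) = ?U (Suc m)" for m
    using assms by (simp add: algebra_simps)
  have R: "?R $$ (a, b) = ?U (Suc (min a b)) * ?U (n - max a b) / d" if "a < n" "b < n" for a b
    using that by (simp add: path_resolvent_def d_def)
  \<comment> \<open>At the two ends of the path the missing neighbour is accounted for by
    \<open>?U 0 = 0\<close>.\<close>
  have left: "(if r > 0 then ?R $$ (r - 1, c) else 0) = ?U r * ?U (n - c) / d" if "r \<le> c"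
    using that rc by (cases r) (auto simp: R min_def max_def)
  have right: "(if Suc r < n then ?R $$ (Suc r, c) else 0) = ?U (Suc c) * ?U (n - Suc r) / d" if "c \<le> r"
    using that rc by (cases "Suc r = n") (auto simp: R min_def max_def)
  consider "r < c" | "c < r" | "r = c" by linarith
  then have "\<alpha> * ((if r > 0 then ?R $$ (r - 1, c) else 0) + (if Suc r < n then ?R $$ (Suc r, c) else 0))
      = ?R $$ (r, c) - (if r = c then 1 else 0)"
  proof cases
    case 1
    then have "?R $$ (Suc r, c) = ?U (Suc (Suc r)) * ?U (n - c) / d" "Suc r < n"
      using rc by (auto simp: R min_def max_def)
    then have "\<alpha> * ((if r > 0 then ?R $$ (r - 1, c) else 0) + (if Suc r < n then ?R $$ (Suc r, c) else 0))
        = (\<alpha> * (?U r + ?U (Suc (Suc r)))) * ?U (n - c) / d"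
      using left 1 by (simp add: algebra_simps add_divide_distrib diff_divide_distrib)
    then show ?thesis unfolding rec using rc 1 by (simp add: R)
  next
    case 2
    have e: "n - r = Suc (n - Suc r)" "n - (r - 1) = Suc (Suc (n - Suc r))" using 2 rc by auto
    have "min (r - 1) c = c" "max (r - 1) c = r - 1" using 2 by auto
    then have "?R $$ (r - 1, c) = ?U (Suc c) * ?U (n - (r - 1)) / d"
      using rc by (simp add: R)
    then have "\<alpha> * ((if r > 0 then ?R $$ (r - 1, c) else 0) + (if Suc r < n then ?R $$ (Suc r, c) else 0))
        = (\<alpha> * (?U (n - Suc r) + ?U (Suc (Suc (n - Suc r))))) * ?U (Suc c) / d"
      unfolding e using right 2 by (simp add: algebra_simps add_divide_distrib diff_divide_distrib)
    then show ?thesis unfolding rec using rc 2 e by (simp add: R)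
  next
    case 3
    define l where "l = n - Suc c"
    have l: "n - c = Suc l" "n = Suc (c + l)" using rc by (auto simp: l_def)
    \<comment> \<open>This instance of the addition formula is what determines the denominator
      \<open>d\<close>.\<close>
    have "?U (Suc n) = ?U (Suc (Suc c)) * ?U (Suc l) - ?U (Suc c) * ?U l"
      using lucas_U_add[of "1 / \<alpha>" "Suc c" l] l(2) by simp
    then have "\<alpha> * (?U c * ?U (Suc l) + ?U (Suc c) * ?U l) = ?U (Suc c) * ?U (Suc l) - d"
      unfolding d_def using assms by (simp add: field_simps)
    then have "\<alpha> * (?U c * ?U (Suc l) / d + ?U (Suc c) * ?U l / d) = ?U (Suc c) * ?U (Suc l) / d - 1"
      using d by (simp add: field_simps)
    then show ?thesis using left right 3 rc l(1) by (simp add: R l_def)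
  qed
  then show "?R $$ (r, c) = (1\<^sub>m n + \<alpha> \<cdot>\<^sub>m (?A * ?R)) $$ (r, c)"
    using rc path_adj_mat_mult_index[of ?R n r c]
      carrier_matD[OF path_resolvent_carrier] carrier_matD[OF path_adj_mat_carrier]
    by (simp del: index_mult_mat(1))
qed (auto simp: path_resolvent_def path_adj_mat_def)

text \<open>A vertex has at most two neighbours, so each factor A at most doubles a bound on the
  entries. The induction absorbs one factor into \<open>M\<close>, which therefore stays
  arbitrary.\<close>

lemma path_adj_mat_pow_mult_bound:
  assumes M: "M \<in> carrier_mat n n" and B: "\<And>r c. r < n \<Longrightarrow> c < n \<Longrightarrow> \<bar>M $$ (r, c)\<bar> \<le> B"
    and "r < n" "c < n"
  shows "\<bar>(path_adj_mat n ^\<^sub>m t * M) $$ (r, c)\<bar> \<le> 2 ^ t * B"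
  using M B
proof (induction t arbitrary: M B)
  case 0
  then show ?case using assms by (simp add: path_adj_mat_def)
next
  case (Suc t)
  let ?A = "path_adj_mat n"
  have AM: "?A * M \<in> carrier_mat n n" using Suc.prems by (meson mult_carrier_mat path_adj_mat_carrier)
  have "\<bar>(?A * M) $$ (r, c)\<bar> \<le> 2 * B" if "r < n" "c < n" for r c
  proof -
    have "B \<ge> 0" using Suc.prems(2)[OF that] by linarith
    then have "\<bar>if r > 0 then M $$ (r - 1, c) else 0\<bar> \<le> B" "\<bar>if Suc r < n then M $$ (Suc r, c) else 0\<bar> \<le> B"
      using that Suc.prems(2) by auto
    then show ?thesis
      unfolding path_adj_mat_mult_index[OF Suc.prems(1) that] by linarith
  qed
  from Suc.IH[OF AM this] have "\<bar>(?A ^\<^sub>m t * (?A * M)) $$ (r, c)\<bar> \<le> 2 ^ t * (2 * B)" by blast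
  moreover have "?A ^\<^sub>m Suc t * M = ?A ^\<^sub>m t * (?A * M)"
    using Suc.prems(1) by (simp add: assoc_mult_mat[of _ n n _ n _ n])
  ultimately show ?case by (simp add: algebra_simps)
qed

text \<open>Multiplying the fixed-point equation by alpha^t A^t writes each term of the series as
  \<open>h t - h (Suc t)\<close>, with \<open>h t\<close> an entry of alpha^t A^t R. Since
  \<open>h t\<close> is O((2 alpha)^t), it tends to 0 and the series telescopes.\<close>

lemma katz_path_eq:
  assumes \<alpha>: "0 < \<alpha>" "\<alpha> < 1 / 2" and ik: "1 \<le> i" "i < k" "k \<le> n"
  shows "katz_path n \<alpha> i k =
    lucas_U (1 / \<alpha>) i * lucas_U (1 / \<alpha>) (Suc n - k) / (\<alpha> * lucas_U (1 / \<alpha>) (Suc n))"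
proof -
  let ?A = "path_adj_mat n" and ?R = "path_resolvent n \<alpha>"
  define r c where "r = i - 1" and "c = k - 1"
  have rc: "r < n" "c < n" "r < c" using ik by (auto simp: r_def c_def)
  define h where "h t = \<alpha> ^ t * (?A ^\<^sub>m t * ?R) $$ (r, c)" for t
  have pow [simp]: "?A ^\<^sub>m t \<in> carrier_mat n n" for t by simp
  have step: "(\<alpha> ^ t \<cdot>\<^sub>m ?A ^\<^sub>m t) $$ (r, c) = h t - h (Suc t)" for t
  proof -
    have AR: "?A * ?R \<in> carrier_mat n n" by (meson mult_carrier_mat path_adj_mat_carrier path_resolvent_carrier)
    have "?A ^\<^sub>m t * ?R = ?A ^\<^sub>m t * (1\<^sub>m n + \<alpha> \<cdot>\<^sub>m (?A * ?R))"
      using path_resolvent_eq[OF \<alpha>] by simp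
    also have "\<dots> = ?A ^\<^sub>m t * 1\<^sub>m n + ?A ^\<^sub>m t * (\<alpha> \<cdot>\<^sub>m (?A * ?R))"
      using AR by (intro mult_add_distrib_mat[of _ n n _ n]) auto
    also have "\<dots> = ?A ^\<^sub>m t + \<alpha> \<cdot>\<^sub>m (?A ^\<^sub>m Suc t * ?R)"
      using AR by (simp add: right_mult_one_mat[OF pow] mult_smult_distrib[of _ n n _ n] assoc_mult_mat[of _ n n _ n _ n])
    finally have eq: "?A ^\<^sub>m t * ?R = ?A ^\<^sub>m t + \<alpha> \<cdot>\<^sub>m (?A ^\<^sub>m Suc t * ?R)" .
    have car: "?A ^\<^sub>m Suc t * ?R \<in> carrier_mat n n" using mult_carrier_mat[OF pow path_resolvent_carrier] .
    have "(?A ^\<^sub>m t * ?R) $$ (r, c) = (?A ^\<^sub>m t) $$ (r, c) + \<alpha> * (?A ^\<^sub>m Suc t * ?R) $$ (r, c)"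
      using arg_cong[OF eq, of "\<lambda>M. M $$ (r, c)"] rc carrier_matD[OF car]
      by (simp del: index_mult_mat(1) pow_mat.simps)
    then show ?thesis
      using rc carrier_matD[OF pow[of t]] by (simp del: index_mult_mat(1) pow_mat.simps add: h_def algebra_simps)
  qed
  have "finite ((\<lambda>(r, c). \<bar>?R $$ (r, c)\<bar>) ` ({..<n} \<times> {..<n}))" by auto
  then have bd: "\<bar>?R $$ (r, c)\<bar> \<le> Max ((\<lambda>(r, c). \<bar>?R $$ (r, c)\<bar>) ` ({..<n} \<times> {..<n}))"
    if "r < n" "c < n" for r c
    using that by (intro Max_ge) auto
  define B where "B = Max ((\<lambda>(r, c). \<bar>?R $$ (r, c)\<bar>) ` ({..<n} \<times> {..<n}))"
  have bound: "\<bar>h t\<bar> \<le> (2 * \<alpha>) ^ t * B" for t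
    using path_adj_mat_pow_mult_bound[OF path_resolvent_carrier bd[folded B_def] rc(1,2), of t] \<alpha>
    by (auto simp: h_def abs_mult power_mult_distrib mult.assoc mult.left_commute intro!: mult_left_mono)
  have "(\<lambda>t. (2 * \<alpha>) ^ t) \<longlonglongrightarrow> 0"
    using \<alpha> by (intro LIMSEQ_power_zero) simp
  then have "h \<longlonglongrightarrow> 0"
    by (rule tendsto_0_le[where K = B]) (use bound \<alpha> in simp)
  then have "(\<lambda>t. h (Suc t)) \<longlonglongrightarrow> 0" by (rule LIMSEQ_Suc)
  from telescope_sums'[OF this]
  have "(\<lambda>t. (\<alpha> ^ Suc t \<cdot>\<^sub>m ?A ^\<^sub>m Suc t) $$ (r, c)) sums h 1"
    unfolding step by simp
  \<comment> \<open>The Katz series starts at t = 1, so its sum is \<open>h 1\<close>; the term for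
    t = 0 is an entry of the identity matrix, which vanishes because \<open>r < c\<close>.\<close>
  moreover have "h 1 = h 0"
    using step[of 0] rc by (simp add: path_adj_mat_def)
  moreover have "h 0 = ?R $$ (r, c)"
    by (simp add: h_def path_adj_mat_def left_mult_one_mat[of _ n n])
  moreover have "?R $$ (r, c) =
      lucas_U (1 / \<alpha>) i * lucas_U (1 / \<alpha>) (Suc n - k) / (\<alpha> * lucas_U (1 / \<alpha>) (Suc n))"
    using rc ik by (simp add: path_resolvent_def r_def c_def min_def max_def)
  moreover have "katz_path n \<alpha> i k = (\<Sum>t. (\<alpha> ^ Suc t \<cdot>\<^sub>m ?A ^\<^sub>m Suc t) $$ (r, c))"
    using rc carrier_matD(1)[OF path_adj_mat_carrier[of n]]
    unfolding katz_path_def katz_mat_def r_def[symmetric] c_def[symmetric] by simp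
  ultimately show ?thesis by (simp add: sums_iff)
qed

section \<open>Extreme entries along a band\<close>

lemma lucas_U_mult_min:
  assumes "x \<ge> 2" "1 \<le> i" "i \<le> m"
  shows "lucas_U x m \<le> lucas_U x i * lucas_U x (Suc m - i)"
proof -
  \<comment> \<open>Vajda's identity is based at index 1, the end of the band, where the product is
    \<open>lucas_U x m\<close>.\<close>
  have "1 + (i - 1) = i" "1 + (m - i) = Suc m - i" "1 + (i - 1) + (m - i) = m" using assms by auto
  with lucas_U_vajda[of x 1 "i - 1" "m - i"]
  have "lucas_U x i * lucas_U x (Suc m - i) - lucas_U x m = lucas_U x (i - 1) * lucas_U x (m - i)"
    by simp
  moreover have "\<dots> \<ge> 0"
    using lucas_U_nonneg[OF assms(1)] by simp
  ultimately show ?thesis by linarith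
qed

text \<open>Up to the middle, Vajda's identity gives the excess of the middle product as a product
  of two nonnegative terms. Beyond it, the symmetry between i and m - i applies.\<close>

lemma lucas_U_mult_max:
  assumes "x \<ge> 2" "i \<le> m"
  shows "lucas_U x i * lucas_U x (m - i) \<le> lucas_U x (m div 2) * lucas_U x (m - m div 2)"
proof -
  have *: "lucas_U x i * lucas_U x (m - i) \<le> lucas_U x (m div 2) * lucas_U x (m - m div 2)"
    if "i \<le> m div 2" for i
  proof -
    define k l where "k = m div 2 - i" and "l = m - m div 2 - i"
    have "i + k = m div 2" "i + l = m - m div 2" "i + k + l = m - i"
      using that by (auto simp: k_def l_def)
    with lucas_U_vajda[of x i k l] lucas_U_nonneg[OF assms(1)] show ?thesis
      by (smt (verit) mult_nonneg_nonneg)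
  qed
  show ?thesis
  proof (cases "i \<le> m div 2")
    case False
    then have "m - i \<le> m div 2" "m - (m - i) = i" using assms by auto
    with *[of "m - i"] show ?thesis by (simp add: mult.commute)
  qed (rule *)
qed

text \<open>Both bands share the denominator \<open>\<alpha> * U (Suc n)\<close>. The minimum is
  attained at \<open>i = 1\<close> on the first, the maximum at \<open>i = m div 2\<close> on the
  second.\<close>

lemma katz_gap_eq:
  assumes \<alpha>: "0 < \<alpha>" "\<alpha> < 1 / 2" and j: "j \<ge> 1" "n \<ge> j + 2"
  defines "U \<equiv> lucas_U (1 / \<alpha>)" and "m \<equiv> n - j"
  shows "katz_gap n j \<alpha> = (U m - U (m div 2) * U (m - m div 2)) / (\<alpha> * U (Suc n))"
proof -
  have x: "1 / \<alpha> \<ge> 2" using \<alpha> by (simp add: field_simps)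
  define d where "d = \<alpha> * U (Suc n)"
  have d: "d > 0" unfolding d_def U_def using \<alpha> lucas_U_pos[OF x, of "Suc n"] by simp
  have m: "2 \<le> m" using j by (simp add: m_def)
  have a: "katz_path n \<alpha> i (i + j) = U i * U (Suc m - i) / d" if "i \<in> {1..m}" for i
  proof -
    have "Suc n - (i + j) = Suc m - i" using that by (auto simp: m_def)
    then show ?thesis using that j by (subst katz_path_eq[OF \<alpha>]) (auto simp: m_def d_def U_def)
  qed
  have b: "katz_path n \<alpha> i (i + j + 1) = U i * U (m - i) / d" if "i \<in> {1..m - 1}" for i
  proof -
    have "Suc n - (i + j + 1) = m - i" using that by (auto simp: m_def)
    then show ?thesis using that j by (subst katz_path_eq[OF \<alpha>]) (auto simp: m_def d_def U_def)
  qed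
  have "(MIN i\<in>{1..m}. katz_path n \<alpha> i (i + j)) = U m / d"
  proof (rule Min_eqI)
    show "U m / d \<in> (\<lambda>i. katz_path n \<alpha> i (i + j)) ` {1..m}"
      using m a[of 1] by (intro image_eqI[of _ _ 1]) (auto simp: U_def)
    show "U m / d \<le> y" if "y \<in> (\<lambda>i. katz_path n \<alpha> i (i + j)) ` {1..m}" for y
      using that d lucas_U_mult_min[OF x] by (auto simp: a U_def intro!: divide_right_mono)
  qed simp
  moreover have "(MAX i\<in>{1..m - 1}. katz_path n \<alpha> i (i + j + 1)) = U (m div 2) * U (m - m div 2) / d"
  proof (rule Max_eqI)
    show "U (m div 2) * U (m - m div 2) / d \<in> (\<lambda>i. katz_path n \<alpha> i (i + j + 1)) ` {1..m - 1}"
    proof (rule image_eqI)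
      show mem: "m div 2 \<in> {1..m - 1}" using m by auto
      show "U (m div 2) * U (m - m div 2) / d = katz_path n \<alpha> (m div 2) (m div 2 + j + 1)"
        by (rule b[OF mem, symmetric])
    qed
    show "y \<le> U (m div 2) * U (m - m div 2) / d"
      if "y \<in> (\<lambda>i. katz_path n \<alpha> i (i + j + 1)) ` {1..m - 1}" for y
      using that d lucas_U_mult_max[OF x] by (auto simp: b[simplified] U_def intro!: divide_right_mono)
  qed simp
  ultimately show ?thesis
    unfolding katz_gap_def d_def[symmetric] m_def[symmetric] by (simp add: diff_divide_distrib)
qed

section \<open>The root by intermediate values\<close>

theorem theorem19:
  fixes n j :: nat
  assumes "n \<ge> 1" and "j \<ge> 1" and "n \<ge> j + 5"
  shows "\<exists>\<alpha>::real. 1 / sqrt 5 < \<alpha> \<and> \<alpha> < 1 / 2 \<and> katz_gap n j \<alpha> = 0"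
proof -
  define m where "m = n - j"
  define a b where "a = m div 2" and "b = m - m div 2"
  have ab: "a + b = m" "2 \<le> a" "3 \<le> b" using assms by (auto simp: a_def b_def m_def)
  \<comment> \<open>The numerator of the gap replaces the gap itself because
    \<open>katz_gap_eq\<close> does not cover the endpoint 1/2.\<close>
  define f where "f \<alpha> = lucas_U (1 / \<alpha>) m - lucas_U (1 / \<alpha>) a * lucas_U (1 / \<alpha>) b" for \<alpha>
  have le: "1 / sqrt 5 \<le> (1 / 2 :: real)"
    by (simp add: field_simps real_le_rsqrt)
  have left: "f (1 / sqrt 5) > 0"
    using lucas_U_sqrt5_mult_less[of a b] ab by (simp add: f_def)
  \<comment> \<open>Here n - j >= 5 enters: for m = 4 both sides would be 4.\<close>
  have "a + b < a * b"
  proof -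
    obtain a' b' where "a = a' + 2" "b = b' + 3" using ab by (metis add.commute le_Suc_ex)
    then show ?thesis by (simp add: algebra_simps)
  qed
  then have "real m < real a * real b"
    unfolding ab(1)[symmetric] of_nat_mult[symmetric] of_nat_less_iff .
  then have right: "f (1 / 2) < 0" by (simp add: f_def lucas_U_two)
  have "(0::real) < 1 / sqrt 5" by simp
  then have "continuous_on {1 / sqrt 5..1 / 2} f"
    unfolding f_def by (intro continuous_intros) auto
  from IVT2'[of f "1 / 2" 0, OF _ _ le this] left right
  obtain \<alpha> where \<alpha>: "1 / sqrt 5 \<le> \<alpha>" "\<alpha> \<le> 1 / 2" "f \<alpha> = 0" by auto
  \<comment> \<open>The strict signs of \<open>f\<close> at the endpoints move the root into the
    open interval.\<close>
  have "\<alpha> \<noteq> 1 / sqrt 5" "\<alpha> \<noteq> 1 / 2" using left right \<alpha>(3) by (metis less_irrefl)+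
  with \<alpha> have lt: "1 / sqrt 5 < \<alpha>" "\<alpha> < 1 / 2" by auto
  with \<open>0 < 1 / sqrt 5\<close> have "0 < \<alpha>" by linarith
  then have "katz_gap n j \<alpha> = 0"
    using katz_gap_eq[of \<alpha> j n] lt assms \<alpha>(3) by (simp add: f_def a_def b_def m_def)
  with lt show ?thesis by blast
qed

end
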